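(* Let $T\subseteq\omega^{<\omega}$ be a tree. Then $\mathcal{A}(T)$ does not have an indiscernible ordered triple of imaginaries.
   Context: A tree $T\subseteq\omega^{<\omega}$ is a set of finite sequences closed under initial segments. The structure $\mathcal{A}(T)$. Let $T_n$ be the set of nodes at level $n$ of $T$. Let $G_n=\mathcal{P}_{<\omega}(T_n)$ be the collection of finite subsets of $T_n$, an abelian group under symmetric difference $\Delta$, with identity $\mathrm{id}_n$ (the empty set, regarded as an element of level $n$, so the $G_n$ are taken to be pairwise disjoint). Let $G=\bigcup_n G_n$. Define $p:G_{n+1}\to G_n$ as follows: if $a=\{t_1,\ldots,t_k\}\in G_{n+1}$, then $p(a)$ is the sum in $G_n$ of (the singletons of) the predecessors of $t_1,\ldots,t_k$; that is, $t^*\in p(a)$ iff the number of successors of $t^*$ in $a$ is odd. For each $a\in G$ define a unary function $f_a:G\to G$: if $a\in G_m$ and $b\in G_n$, let $k=\min(m,n)$ and $f_a(b)=p^{m-k}(a)\,\Delta\,p^{n-k}(b)\in G_k$. Then $\mathcal{A}(T)$ is the structure $(G,(f_a)_{a\in G})$, with one unary function symbol for each $a\in G$. An indiscernible ordered triple of imaginaries of a structure $\mathcal{A}$ is a sequence $(E_1,E_2,E_3)$ of pairwise distinct equivalence classes of elements of $\mathcal{A}$, modulo some equivalence relation definable in $\mathcal{A}$ by an $L_{\omega_1\omega}$ formula without parameters, such that for any $n$ and any $i_1<\dots<i_n$ and $j_1<\dots<j_n$ in $\{1,2,3\}$ there is an automorphism of $\mathcal{A}$ mapping $E_{i_k}$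 to $E_{j_k}$ for each $k=1,\dots,n$. *)

theory Defs
  imports Main "HOL-Library.Sublist"
begin

text \<open>All functions are only meaningful on the universe: everything below is relativised to it.\<close>

record ('i, 'a) ustruct =
  universe :: "'a set"
  symbols :: "'i set"
  func :: "'i \<Rightarrow> 'a \<Rightarrow> 'a"

definition automorphism :: "('i, 'a) ustruct \<Rightarrow> ('a \<Rightarrow> 'a) \<Rightarrow> bool" where
  "automorphism M g \<longleftrightarrow> bij_betw g (universe M) (universe M) \<and>
     (\<forall>i\<in>symbols M. \<forall>x\<in>universe M. g (func M i x) = func M i (g x))"

datatype 'i trm = Var nat | App 'i "'i trm"

text \<open>
  Countable conjunctions are indexed by the natural numbers; finite nonempty ones arise by
  repeating a conjunct, and the empty one is equivalent to any valid formula. Countable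
  disjunctions and universal quantifiers are obtained by negation. A formula with finitely many
  free variables has only subformulas with finitely many free variables, so no separate
  condition on subformulas is needed.
\<close>

datatype 'i fm =
    Eq "'i trm" "'i trm"
  | Neg "'i fm"
  | Conj "nat \<Rightarrow> 'i fm"
  | Exists nat "'i fm"

primrec trm_vars :: "'i trm \<Rightarrow> nat set" where
  "trm_vars (Var n) = {n}"
| "trm_vars (App i t) = trm_vars t"

primrec free_vars :: "'i fm \<Rightarrow> nat set" where
  "free_vars (Eq s t) = trm_vars s \<union> trm_vars t"
| "free_vars (Neg \<phi>) = free_vars \<phi>"
| "free_vars (Conj \<Phi>) = (\<Union>n. free_vars (\<Phi> n))"
| "free_vars (Exists n \<phi>) = free_vars \<phi> - {n}"

primrec trm_symbols :: "'i trm \<Rightarrow> 'i set" where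
  "trm_symbols (Var n) = {}"
| "trm_symbols (App i t) = insert i (trm_symbols t)"

primrec fm_symbols :: "'i fm \<Rightarrow> 'i set" where
  "fm_symbols (Eq s t) = trm_symbols s \<union> trm_symbols t"
| "fm_symbols (Neg \<phi>) = fm_symbols \<phi>"
| "fm_symbols (Conj \<Phi>) = (\<Union>n. fm_symbols (\<Phi> n))"
| "fm_symbols (Exists n \<phi>) = fm_symbols \<phi>"

primrec trm_val :: "('i, 'a) ustruct \<Rightarrow> (nat \<Rightarrow> 'a) \<Rightarrow> 'i trm \<Rightarrow> 'a" where
  "trm_val M v (Var n) = v n"
| "trm_val M v (App i t) = func M i (trm_val M v t)"

primrec sat :: "('i, 'a) ustruct \<Rightarrow> (nat \<Rightarrow> 'a) \<Rightarrow> 'i fm \<Rightarrow> bool" where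
  "sat M v (Eq s t) \<longleftrightarrow> trm_val M v s = trm_val M v t"
| "sat M v (Neg \<phi>) \<longleftrightarrow> \<not> sat M v \<phi>"
| "sat M v (Conj \<Phi>) \<longleftrightarrow> (\<forall>n. sat M v (\<Phi> n))"
| "sat M v (Exists n \<phi>) \<longleftrightarrow> (\<exists>x\<in>universe M. sat M (v(n := x)) \<phi>)"

text \<open>The variables 0 and 1 stand for the two arguments of the defined relation.\<close>

definition definable_rel :: "('i, 'a) ustruct \<Rightarrow> ('a \<times> 'a) set \<Rightarrow> bool" where
  "definable_rel M R \<longleftrightarrow>
     (\<exists>\<phi>. free_vars \<phi> \<subseteq> {0, 1} \<and> fm_symbols \<phi> \<subseteq> symbols M \<and>
        R = {(x, y). x \<in> universe M \<and> y \<in> universe M \<and> sat M (\<lambda>i. if i = 0 then x else y) \<phi>})"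

text \<open>The triple is the restriction of \<open>E\<close> to the indices 1, 2, 3.\<close>

definition indiscernible_triple :: "('i, 'a) ustruct \<Rightarrow> (nat \<Rightarrow> 'a set) \<Rightarrow> bool" where
  "indiscernible_triple M E \<longleftrightarrow>
     (\<exists>R. equiv (universe M) R \<and> definable_rel M R \<and> (\<forall>i\<in>{1, 2, 3}. E i \<in> universe M // R)) \<and>
     inj_on E {1, 2, 3} \<and>
     (\<forall>(n::nat) i j.
        strict_mono_on {1..n} i \<and> i ` {1..n} \<subseteq> {1, 2, 3} \<and>
        strict_mono_on {1..n} j \<and> j ` {1..n} \<subseteq> {1, 2, 3} \<longrightarrow>
        (\<exists>g. automorphism M g \<and> (\<forall>k\<in>{1..n}. g ` E (i k) = E (j k))))"

definition is_tree :: "nat list set \<Rightarrow> bool" where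
  "is_tree T \<longleftrightarrow> (\<forall>s t. t \<in> T \<and> prefix s t \<longrightarrow> s \<in> T)"

definition tree_level :: "nat list set \<Rightarrow> nat \<Rightarrow> nat list set" where
  "tree_level T n = {t \<in> T. length t = n}"

text \<open>
  An element of level \<open>n\<close> is tagged with \<open>n\<close>, which makes the levels disjoint;
  in particular the identities \<open>(n, {})\<close> are distinct.
\<close>

type_synonym elt = "nat \<times> nat list set"

definition tree_G_level :: "nat list set \<Rightarrow> nat \<Rightarrow> elt set" where
  "tree_G_level T n = {n} \<times> {a. finite a \<and> a \<subseteq> tree_level T n}"

definition tree_G :: "nat list set \<Rightarrow> elt set" where
  "tree_G T = (\<Union>n. tree_G_level T n)"

text \<open>Used only for elements of positive level; the value at level 0 is irrelevant.\<close>

definition tree_p :: "elt \<Rightarrow> elt" where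
  "tree_p x = (fst x - 1, {s. odd (card {t \<in> snd x. \<exists>k. t = s @ [k]})})"

definition tree_f :: "elt \<Rightarrow> elt \<Rightarrow> elt" where
  "tree_f a b =
     (let m = fst a; n = fst b; k = min m n
      in (k, sym_diff (snd ((tree_p ^^ (m - k)) a)) (snd ((tree_p ^^ (n - k)) b))))"

definition tree_struct :: "nat list set \<Rightarrow> (elt, elt) ustruct" where
  "tree_struct T = \<lparr>universe = tree_G T, symbols = tree_G T, func = tree_f\<rparr>"

lemma tree_p_level:
  assumes "is_tree T" "x \<in> tree_G_level T (Suc n)"
  shows "tree_p x \<in> tree_G_level T n"
proof -
  obtain a where x: "x = (Suc n, a)" and fin: "finite a" and a: "a \<subseteq> tree_level T (Suc n)"
    using assms(2) by (auto simp: tree_G_level_def)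
  let ?b = "{s. odd (card {t \<in> a. \<exists>k. t = s @ [k]})}"
  have ex: "\<exists>k. s @ [k] \<in> a" if "s \<in> ?b" for s
  proof (rule ccontr)
    assume "\<nexists>k. s @ [k] \<in> a"
    then have "{t \<in> a. \<exists>k. t = s @ [k]} = {}" by blast
    with that show False by simp
  qed
  have "?b \<subseteq> butlast ` a"
    using ex by (force simp: image_iff)
  then have "finite ?b" using fin finite_subset by blast
  moreover have "?b \<subseteq> tree_level T n"
  proof
    fix s assume "s \<in> ?b"
    then obtain k where "s @ [k] \<in> a" using ex by blast
    then have "s @ [k] \<in> T" "length s = n" using a by (auto simp: tree_level_def)
    then show "s \<in> tree_level T n"
      using assms(1) unfolding tree_level_def is_tree_def by (blast intro: prefixI)
  qed
  ultimately show ?thesis by (simp add: x tree_p_def tree_G_level_def)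
qed

lemma tree_p_funpow_level:
  assumes "is_tree T" "x \<in> tree_G_level T (n + d)"
  shows "(tree_p ^^ d) x \<in> tree_G_level T n"
  using assms(2)
proof (induction d arbitrary: x)
  case (Suc d)
  then have "tree_p x \<in> tree_G_level T (n + d)"
    using tree_p_level[OF assms(1)] by simp
  then show ?case using Suc.IH by (simp add: funpow_swap1)
qed simp

lemma tree_f_closed:
  assumes "is_tree T" "a \<in> tree_G T" "b \<in> tree_G T"
  shows "tree_f a b \<in> tree_G T"
proof -
  let ?k = "min (fst a) (fst b)"
  have "a \<in> tree_G_level T (?k + (fst a - ?k))" "b \<in> tree_G_level T (?k + (fst b - ?k))"
    using assms(2,3) by (auto simp: tree_G_def tree_G_level_def)
  then have "(tree_p ^^ (fst a - ?k)) a \<in> tree_G_level T ?k"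
    "(tree_p ^^ (fst b - ?k)) b \<in> tree_G_level T ?k"
    using tree_p_funpow_level[OF assms(1)] by blast+
  then have "tree_f a b \<in> tree_G_level T ?k"
    by (auto simp: tree_f_def Let_def tree_G_level_def)
  then show ?thesis by (auto simp: tree_G_def)
qed

end

theory Submission imports Defs begin

text \<open>
  Every automorphism \<open>g\<close> of \<open>\<A>(T)\<close> is an involution. It preserves levels, because having level
  at most \<open>k\<close> is the same as being fixed by \<open>f\<^sub>a\<close> for the identity \<open>a\<close> of level \<open>k\<close>. On a single
  level \<open>f\<^sub>a\<close> is translation by \<open>a\<close> in a group of exponent 2, so with \<open>a = b \<Delta> g b\<close> we have
  \<open>f\<^sub>a b = g b\<close> and \<open>f\<^sub>a (g b) = b\<close>, whence \<open>g (g b) = g (f\<^sub>a b) = f\<^sub>a (g b) = b\<close>.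

  Indiscernibility would give an automorphism that moves \<open>(E\<^sub>1, E\<^sub>2)\<close> to \<open>(E\<^sub>2, E\<^sub>3)\<close>. For an
  involution this forces \<open>E\<^sub>3 = E\<^sub>1\<close>, although the classes are distinct.
\<close>

lemma funpow_tree_p_empty: "snd ((tree_p ^^ d) (k, {})) = {}"
proof -
  have "(tree_p ^^ d) (k, {}) = (k - d, {})"
    by (induction d) (simp_all add: tree_p_def)
  then show ?thesis by simp
qed

text \<open>
  The levels can be read off from the unary functions: applying \<open>f\<^sub>a\<close> for the identity \<open>a\<close> of
  level \<open>k\<close> projects the higher levels down to level \<open>k\<close> and leaves the other elements alone.
\<close>

lemma tree_f_identity_fixes_iff: "tree_f (k, {}) b = b \<longleftrightarrow> fst b \<le> k"
proof
  assume "tree_f (k, {}) b = b"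
  then have "fst (tree_f (k, {}) b) = fst b" by simp
  then show "fst b \<le> k" by (simp add: tree_f_def Let_def)
next
  assume "fst b \<le> k"
  then show "tree_f (k, {}) b = b"
    by (simp add: tree_f_def Let_def funpow_tree_p_empty min_absorb2)
qed

lemma tree_f_same_level:
  assumes "fst a = fst b"
  shows "tree_f a b = (fst b, sym_diff (snd a) (snd b))"
  using assms by (simp add: tree_f_def Let_def)

lemma identity_in_tree_G: "(k, {}) \<in> tree_G T"
  by (simp add: tree_G_def tree_G_level_def)

lemma automorphism_tree_structD:
  assumes "automorphism (tree_struct T) g"
  shows "bij_betw g (tree_G T) (tree_G T)"
    and "\<And>a b. a \<in> tree_G T \<Longrightarrow> b \<in> tree_G T \<Longrightarrow> g (tree_f a b) = tree_f a (g b)"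
  using assms by (simp_all add: automorphism_def tree_struct_def)

lemma automorphism_preserves_level:
  assumes T: "is_tree T" and g: "automorphism (tree_struct T) g" and b: "b \<in> tree_G T"
  shows "fst (g b) = fst b"
proof -
  have "fst (g b) \<le> k \<longleftrightarrow> fst b \<le> k" for k
  proof -
    have "fst (g b) \<le> k \<longleftrightarrow> tree_f (k, {}) (g b) = g b"
      by (simp add: tree_f_identity_fixes_iff)
    also have "\<dots> \<longleftrightarrow> g (tree_f (k, {}) b) = g b"
      by (simp add: automorphism_tree_structD(2)[OF g identity_in_tree_G b])
    also have "\<dots> \<longleftrightarrow> tree_f (k, {}) b = b"
      using bij_betw_imp_inj_on[OF automorphism_tree_structD(1)[OF g]]
        tree_f_closed[OF T identity_in_tree_G b] b
      by (auto dest: inj_onD)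
    also have "\<dots> \<longleftrightarrow> fst b \<le> k"
      by (simp add: tree_f_identity_fixes_iff)
    finally show ?thesis .
  qed
  then show ?thesis by (meson order_antisym order_refl)
qed

lemma automorphism_involution:
  assumes T: "is_tree T" and g: "automorphism (tree_struct T) g" and b: "b \<in> tree_G T"
  shows "g (g b) = b"
proof -
  have gb: "g b \<in> tree_G T"
    using automorphism_tree_structD(1)[OF g] b by (rule bij_betwE[rule_format])
  have level: "fst (g b) = fst b"
    using automorphism_preserves_level[OF T g b] .
  \<comment> \<open>The difference of \<open>b\<close> and \<open>g b\<close>; translating by it exchanges the two.\<close>
  define a where "a = tree_f b (g b)"
  have a: "a \<in> tree_G T"
    unfolding a_def using tree_f_closed[OF T b gb] .
  have a_eq: "a = (fst b, sym_diff (snd b) (snd (g b)))"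
    using level by (simp add: a_def tree_f_same_level)
  have "g b = tree_f a b"
    using level by (auto simp: a_eq tree_f_same_level prod_eq_iff)
  then have "g (g b) = g (tree_f a b)" by simp
  also have "\<dots> = tree_f a (g b)"
    using automorphism_tree_structD(2)[OF g a b] .
  also have "\<dots> = b"
    using level by (auto simp: a_eq tree_f_same_level prod_eq_iff)
  finally show ?thesis .
qed

theorem lemma3p7:
  fixes T :: "nat list set"
  assumes "is_tree T"
  shows "\<not> (\<exists>E. indiscernible_triple (tree_struct T) E)"
proof
  assume "\<exists>E. indiscernible_triple (tree_struct T) E"
  then obtain E where E: "indiscernible_triple (tree_struct T) E" ..
  then obtain R where equiv: "equiv (universe (tree_struct T)) R"
    and class1: "E 1 \<in> universe (tree_struct T) // R"
    unfolding indiscernible_triple_def by auto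
  have inj: "inj_on E {1, 2, 3}"
    using E by (simp add: indiscernible_triple_def)
  have indisc: "\<exists>g. automorphism (tree_struct T) g \<and> (\<forall>k\<in>{1..n}. g ` E (i k) = E (j k))"
    if "strict_mono_on {1..n} i \<and> i ` {1..n} \<subseteq> {1, 2, 3} \<and>
        strict_mono_on {1..n} j \<and> j ` {1..n} \<subseteq> {1, 2, 3}"
    for n :: nat and i j :: "nat \<Rightarrow> nat"
    using E[unfolded indiscernible_triple_def, THEN conjunct2, THEN conjunct2, rule_format, OF that] .
  have "\<exists>g. automorphism (tree_struct T) g \<and> (\<forall>k\<in>{1..2}. g ` E (id k) = E (Suc k))"
    by (rule indisc) (auto simp: strict_mono_on_def)
  then obtain g where g: "automorphism (tree_struct T) g"
    and g1: "g ` E 1 = E 2" and g2: "g ` E 2 = E 3"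
    by (auto simp: numeral_eq_Suc)
  have "E 1 \<subseteq> tree_G T"
    using equiv class1 in_quotient_imp_subset[of "tree_G T" R "E 1"] by (simp add: tree_struct_def)
  then have "g (g x) = x" if "x \<in> E 1" for x
    using automorphism_involution[OF assms g] that by blast
  then have "(\<lambda>x. g (g x)) ` E 1 = E 1"
    by simp
  then have "E 3 = E 1"
    using g1 g2 by (metis image_image)
  then show False
    using inj by (auto dest: inj_onD)
qed

end
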